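(* Let $M$ be a regular canal surface in $\mathbb{R}^3$. Then $M$ is an $(H,K)$-Weingarten canal surface if $M$ is one of the following surfaces: a surface of revolution, a cylinder, or a tubular surface whose center curve has nonzero constant curvature.
   Context: A canal surface in $\mathbb{R}^3$ is the envelope of a 1-parameter family of spheres; the curve $\alpha$ formed by the centers of the spheres is its center curve and $r(s)$, the radius of the sphere centered at $\alpha(s)$, is its radius. For a unit speed center curve $\alpha:I\to\mathbb{R}^3$ with Frenet frame $T,N,B$, curvature $\kappa$ and torsion $\tau$ (if $\alpha$ is a straight line, $\kappa=0$ and $T,N,B$ is a constant orthonormal frame), the canal surface is parametrized by $$C(s,t)=\alpha(s)-R(s)T-Q(s)\cos(t)N+Q(s)\sin(t)B,\qquad R=rr',\quad Q=\pm r\sqrt{1-r'^2}.$$ Regular means that the first fundamental form is nondegenerate. Within this class, a tubular surface (tube) is a canal surface with constant radius $r$; a surface of revolution is a canal surface whose center curve is a straight line ($\kappa=0$); a cylinder has $\kappa=0$ and $r$ constant. With $E=\langle C_s,C_s\rangle$, $F=\langle C_s,C_t\rangle$, $G=\langle C_t,C_t\rangle$, $n$ a unit normal, $e=\langle C_{ss},n\rangle$, $f=\langle C_{st},n\rangle$, $g=\langle C_{tt},n\rangle$, the Gaussian and mean curvatures are $K=\frac{eg-f^2}{EG-F^2}$ and $H=\frac{Eg-2Ff+Ge}{2(EG-F^2)}$. The surface is called $(X,Y)$-Weingarten if the Jacobi function $\Phi(X,Y)=X_sY_t-X_tY_s$ vanishes identically. *)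

theory Defs
  imports "HOL-Analysis.Analysis"
begin

section \<open>Smooth functions of one real variable\<close>

definition vderiv :: "(real \<Rightarrow> 'a::real_normed_vector) \<Rightarrow> real \<Rightarrow> 'a" where
  "vderiv f = (\<lambda>s. vector_derivative f (at s))"

definition smooth_on_interval :: "real set \<Rightarrow> (real \<Rightarrow> 'a::real_normed_vector) \<Rightarrow> bool" where
  "smooth_on_interval I f \<longleftrightarrow> (\<forall>k. \<forall>s\<in>I. (vderiv ^^ k) f differentiable (at s))"

section \<open>Unit speed curves and their Frenet frame\<close>

definition curvature :: "(real \<Rightarrow> real^3) \<Rightarrow> real \<Rightarrow> real" where
  "curvature \<alpha> s = norm (vderiv (vderiv \<alpha>) s)"

text \<open>
  For a unit speed curve. Either the curvature vanishes nowhere on \<open>I\<close> and \<open>T, N, B\<close> is the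
  classical Frenet frame, or the curve is a straight line and \<open>T, N, B\<close> is a constant
  orthonormal frame, of either orientation. Curves with isolated inflection points
  have no Frenet frame in this sense.
\<close>

definition frenet_frame ::
  "real set \<Rightarrow> (real \<Rightarrow> real^3) \<Rightarrow> (real \<Rightarrow> real^3) \<Rightarrow> (real \<Rightarrow> real^3) \<Rightarrow> (real \<Rightarrow> real^3) \<Rightarrow> bool"
where
  "frenet_frame I \<alpha> T N B \<longleftrightarrow>
     (\<forall>s\<in>I. T s = vderiv \<alpha> s) \<and>
     ((\<forall>s\<in>I. curvature \<alpha> s \<noteq> 0 \<and>
             N s = (1 / curvature \<alpha> s) *\<^sub>R vderiv (vderiv \<alpha>) s \<and>
             B s = cross3 (T s) (N s)) \<or>
      ((\<forall>s\<in>I. curvature \<alpha> s = 0) \<and>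
       (\<exists>N0 B0. \<forall>s\<in>I. N s = N0 \<and> B s = B0 \<and> norm N0 = 1 \<and> norm B0 = 1 \<and>
             T s \<bullet> N0 = 0 \<and> T s \<bullet> B0 = 0 \<and> N0 \<bullet> B0 = 0)))"

section \<open>Canal surfaces\<close>

text \<open>
  Data of a canal surface: the center curve \<open>\<alpha>\<close>, the radius \<open>r\<close>, the Frenet frame, and the
  sign \<open>\<epsilon>\<close> in \<open>Q = \<plusminus>r \<surd>(1 - r'\<^sup>2)\<close>. The bound on \<open>r'\<close> makes that root real; note that
  \<^const>\<open>sqrt\<close> is also defined (and negative) on negative numbers.
\<close>

locale canal_surface =
  fixes I :: "real set"
    and \<alpha> :: "real \<Rightarrow> real^3"
    and r :: "real \<Rightarrow> real"
    and T N B :: "real \<Rightarrow> real^3"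
    and \<epsilon> :: real
  assumes interval: "open I" "is_interval I" "I \<noteq> {}"
    and smooth_center: "smooth_on_interval I \<alpha>"
    and unit_speed: "s \<in> I \<Longrightarrow> norm (vderiv \<alpha> s) = 1"
    and frame: "frenet_frame I \<alpha> T N B"
    and smooth_radius: "smooth_on_interval I r"
    and radius_pos: "s \<in> I \<Longrightarrow> r s > 0"
    and radius_deriv: "s \<in> I \<Longrightarrow> (vderiv r s)\<^sup>2 \<le> 1"
    and sign: "\<epsilon> = 1 \<or> \<epsilon> = -1"

definition canal_R :: "(real \<Rightarrow> real) \<Rightarrow> real \<Rightarrow> real" where
  "canal_R r s = r s * vderiv r s"

definition canal_Q :: "real \<Rightarrow> (real \<Rightarrow> real) \<Rightarrow> real \<Rightarrow> real" where
  "canal_Q \<epsilon> r s = \<epsilon> * r s * sqrt (1 - (vderiv r s)\<^sup>2)"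

definition canal_param ::
  "(real \<Rightarrow> real^3) \<Rightarrow> (real \<Rightarrow> real) \<Rightarrow> (real \<Rightarrow> real^3) \<Rightarrow> (real \<Rightarrow> real^3) \<Rightarrow> (real \<Rightarrow> real^3) \<Rightarrow>
   real \<Rightarrow> real \<Rightarrow> real \<Rightarrow> real^3"
where
  "canal_param \<alpha> r T N B \<epsilon> s t =
     \<alpha> s - canal_R r s *\<^sub>R T s - (canal_Q \<epsilon> r s * cos t) *\<^sub>R N s + (canal_Q \<epsilon> r s * sin t) *\<^sub>R B s"

definition tubular :: "real set \<Rightarrow> (real \<Rightarrow> real) \<Rightarrow> bool" where
  "tubular I r \<longleftrightarrow> (\<exists>c. \<forall>s\<in>I. r s = c)"

definition surface_of_revolution :: "real set \<Rightarrow> (real \<Rightarrow> real^3) \<Rightarrow> bool" where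
  "surface_of_revolution I \<alpha> \<longleftrightarrow> (\<forall>s\<in>I. curvature \<alpha> s = 0)"

definition cylinder :: "real set \<Rightarrow> (real \<Rightarrow> real^3) \<Rightarrow> (real \<Rightarrow> real) \<Rightarrow> bool" where
  "cylinder I \<alpha> r \<longleftrightarrow> (\<forall>s\<in>I. curvature \<alpha> s = 0) \<and> (\<exists>c. \<forall>s\<in>I. r s = c)"

section \<open>Geometry of parametrized surfaces\<close>

definition pd_s :: "(real \<Rightarrow> real \<Rightarrow> 'a::real_normed_vector) \<Rightarrow> real \<Rightarrow> real \<Rightarrow> 'a" where
  "pd_s X s t = vector_derivative (\<lambda>u. X u t) (at s)"

definition pd_t :: "(real \<Rightarrow> real \<Rightarrow> 'a::real_normed_vector) \<Rightarrow> real \<Rightarrow> real \<Rightarrow> 'a" where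
  "pd_t X s t = vector_derivative (\<lambda>v. X s v) (at t)"

definition ff_E :: "(real \<Rightarrow> real \<Rightarrow> real^3) \<Rightarrow> real \<Rightarrow> real \<Rightarrow> real" where
  "ff_E C s t = pd_s C s t \<bullet> pd_s C s t"

definition ff_F :: "(real \<Rightarrow> real \<Rightarrow> real^3) \<Rightarrow> real \<Rightarrow> real \<Rightarrow> real" where
  "ff_F C s t = pd_s C s t \<bullet> pd_t C s t"

definition ff_G :: "(real \<Rightarrow> real \<Rightarrow> real^3) \<Rightarrow> real \<Rightarrow> real \<Rightarrow> real" where
  "ff_G C s t = pd_t C s t \<bullet> pd_t C s t"

definition regular_surface :: "real set \<Rightarrow> (real \<Rightarrow> real \<Rightarrow> real^3) \<Rightarrow> bool" where
  "regular_surface I C \<longleftrightarrow>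
     (\<forall>s\<in>I. \<forall>t. ff_E C s t * ff_G C s t - (ff_F C s t)\<^sup>2 \<noteq> 0)"

text \<open>Continuity rules out a choice of the sign of the normal that jumps from point to point.\<close>

definition unit_normal ::
  "real set \<Rightarrow> (real \<Rightarrow> real \<Rightarrow> real^3) \<Rightarrow> (real \<Rightarrow> real \<Rightarrow> real^3) \<Rightarrow> bool"
where
  "unit_normal I C n \<longleftrightarrow>
     continuous_on (I \<times> UNIV) (\<lambda>(s, t). n s t) \<and>
     (\<forall>s\<in>I. \<forall>t. norm (n s t) = 1 \<and> n s t \<bullet> pd_s C s t = 0 \<and> n s t \<bullet> pd_t C s t = 0)"

definition sf_e ::
  "(real \<Rightarrow> real \<Rightarrow> real^3) \<Rightarrow> (real \<Rightarrow> real \<Rightarrow> real^3) \<Rightarrow> real \<Rightarrow> real \<Rightarrow> real" where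
  "sf_e C n s t = pd_s (pd_s C) s t \<bullet> n s t"

definition sf_f ::
  "(real \<Rightarrow> real \<Rightarrow> real^3) \<Rightarrow> (real \<Rightarrow> real \<Rightarrow> real^3) \<Rightarrow> real \<Rightarrow> real \<Rightarrow> real" where
  "sf_f C n s t = pd_t (pd_s C) s t \<bullet> n s t"

definition sf_g ::
  "(real \<Rightarrow> real \<Rightarrow> real^3) \<Rightarrow> (real \<Rightarrow> real \<Rightarrow> real^3) \<Rightarrow> real \<Rightarrow> real \<Rightarrow> real" where
  "sf_g C n s t = pd_t (pd_t C) s t \<bullet> n s t"

definition gauss_curvature ::
  "(real \<Rightarrow> real \<Rightarrow> real^3) \<Rightarrow> (real \<Rightarrow> real \<Rightarrow> real^3) \<Rightarrow> real \<Rightarrow> real \<Rightarrow> real" where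
  "gauss_curvature C n s t =
     (sf_e C n s t * sf_g C n s t - (sf_f C n s t)\<^sup>2) /
     (ff_E C s t * ff_G C s t - (ff_F C s t)\<^sup>2)"

definition mean_curvature ::
  "(real \<Rightarrow> real \<Rightarrow> real^3) \<Rightarrow> (real \<Rightarrow> real \<Rightarrow> real^3) \<Rightarrow> real \<Rightarrow> real \<Rightarrow> real" where
  "mean_curvature C n s t =
     (ff_E C s t * sf_g C n s t - 2 * ff_F C s t * sf_f C n s t + ff_G C s t * sf_e C n s t) /
     (2 * (ff_E C s t * ff_G C s t - (ff_F C s t)\<^sup>2))"

definition jacobi_fun ::
  "(real \<Rightarrow> real \<Rightarrow> real) \<Rightarrow> (real \<Rightarrow> real \<Rightarrow> real) \<Rightarrow> real \<Rightarrow> real \<Rightarrow> real" where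
  "jacobi_fun X Y s t = pd_s X s t * pd_t Y s t - pd_t X s t * pd_s Y s t"

definition weingarten ::
  "real set \<Rightarrow> (real \<Rightarrow> real \<Rightarrow> real) \<Rightarrow> (real \<Rightarrow> real \<Rightarrow> real) \<Rightarrow> bool" where
  "weingarten I X Y \<longleftrightarrow> (\<forall>s\<in>I. \<forall>t. jacobi_fun X Y s t = 0)"

section \<open>The parametrization covers the envelope of the spheres\<close>

text \<open>
  The envelope of the spheres with center \<open>\<alpha> s\<close> and radius \<open>r s\<close>, defined by
  \<open>f x s = 0\<close> and \<open>\<partial>f/\<partial>s x s = 0\<close> with \<open>f x s = \<parallel>x - \<alpha> s\<parallel>\<^sup>2 - (r s)\<^sup>2\<close>.
\<close>

definition sphere_envelope :: "real set \<Rightarrow> (real \<Rightarrow> real^3) \<Rightarrow> (real \<Rightarrow> real) \<Rightarrow> (real^3) set" where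
  "sphere_envelope I \<alpha> r =
     {x. \<exists>s\<in>I. (norm (x - \<alpha> s))\<^sup>2 - (r s)\<^sup>2 = 0 \<and>
              vderiv (\<lambda>u. (norm (x - \<alpha> u))\<^sup>2 - (r u)\<^sup>2) s = 0}"

lemma smooth_on_intervalD:
  assumes "smooth_on_interval I f" "s \<in> I"
  shows "(f has_vector_derivative vderiv f s) (at s)"
    and "(vderiv f has_vector_derivative vderiv (vderiv f) s) (at s)"
proof -
  have "(vderiv ^^ 0) f differentiable (at s)" "(vderiv ^^ 1) f differentiable (at s)"
    using assms unfolding smooth_on_interval_def by blast+
  then show "(f has_vector_derivative vderiv f s) (at s)"
    and "(vderiv f has_vector_derivative vderiv (vderiv f) s) (at s)"
    by (simp_all add: vector_derivative_works vderiv_def)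
qed

lemma orthonormal_expansion_3:
  fixes a b c x :: "real^3"
  assumes "norm a = 1" "norm b = 1" "norm c = 1" "a \<bullet> b = 0" "a \<bullet> c = 0" "b \<bullet> c = 0"
  shows "x = (x \<bullet> a) *\<^sub>R a + (x \<bullet> b) *\<^sub>R b + (x \<bullet> c) *\<^sub>R c"
proof -
  define w where "w = cross3 a b"
  have nw: "norm w = 1"
  proof -
    have "(norm w)\<^sup>2 = 1"
      using norm_cross_dot[of a b] assms by (simp add: w_def)
    then show ?thesis by (simp add: power2_eq_1_iff) (use norm_ge_zero[of w] in linarith)
  qed
  have par: "cross3 y w = 0" if "y \<bullet> a = 0" "y \<bullet> b = 0" for y
  proof -
    have "cross3 y w = (y \<bullet> b) *\<^sub>R a - (y \<bullet> a) *\<^sub>R b"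
      unfolding w_def by (rule Lagrange)
    then show ?thesis using that by simp
  qed
  have "cross3 c w = 0"
    using assms by (intro par) (simp_all add: inner_commute)
  then have cw: "(c \<bullet> w)\<^sup>2 = 1"
    using norm_cross_dot[of c w] nw assms by simp
  have w_eq: "w = (c \<bullet> w) *\<^sub>R c"
  proof -
    have "(w - (c \<bullet> w) *\<^sub>R c) \<bullet> (w - (c \<bullet> w) *\<^sub>R c) =
        w \<bullet> w - 2 * (c \<bullet> w)\<^sup>2 + (c \<bullet> w)\<^sup>2 * (c \<bullet> c)"
      by (simp only: inner_diff_left inner_diff_right inner_scaleR_left inner_scaleR_right
          inner_commute[of w c] power2_eq_square) (simp add: algebra_simps)
    also have "\<dots> = 0" using nw assms(3) cw by (simp add: norm_eq_1)
    finally show ?thesis by (simp only: inner_eq_zero_iff right_minus_eq)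
  qed
  define y where "y = x - ((x \<bullet> a) *\<^sub>R a + (x \<bullet> b) *\<^sub>R b + (x \<bullet> c) *\<^sub>R c)"
  have y: "y \<bullet> a = 0" "y \<bullet> b = 0" "y \<bullet> c = 0"
    using assms by (simp_all add: y_def norm_eq_1 inner_diff_left inner_diff_right
        inner_add_left inner_add_right inner_commute)
  have "y \<bullet> w = 0"
    by (subst w_eq) (simp add: y)
  then have "(norm y * norm w)\<^sup>2 = 0"
    using norm_cross_dot[of y w] par[OF y(1,2)] by simp
  then have "y = 0" using nw by simp
  then show ?thesis by (simp add: y_def)
qed

context canal_surface
begin

lemma frame_orthonormal:
  assumes s: "s \<in> I"
  shows "norm (T s) = 1" "norm (N s) = 1" "norm (B s) = 1"
    "T s \<bullet> N s = 0" "T s \<bullet> B s = 0" "N s \<bullet> B s = 0"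
proof -
  have T: "T s = vderiv \<alpha> s" using frame s by (simp add: frenet_frame_def)
  show T1: "norm (T s) = 1" using unit_speed[OF s] T by simp
  have dd: "(vderiv \<alpha> has_vector_derivative vderiv (vderiv \<alpha>) s) (at s)"
    by (rule smooth_on_intervalD[OF smooth_center s])
  have "((\<lambda>u. vderiv \<alpha> u \<bullet> vderiv \<alpha> u) has_vector_derivative
      (vderiv \<alpha> s \<bullet> vderiv (vderiv \<alpha>) s + vderiv (vderiv \<alpha>) s \<bullet> vderiv \<alpha> s)) (at s)"
    by (rule bounded_bilinear.has_vector_derivative[OF bounded_bilinear_inner dd dd])
  moreover have "((\<lambda>u. vderiv \<alpha> u \<bullet> vderiv \<alpha> u) has_vector_derivative 0) (at s)"
  proof (rule has_vector_derivative_transform_within_open[OF _ interval(1) s])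
    show "((\<lambda>u. 1 :: real) has_vector_derivative 0) (at s)" by simp
    show "1 = vderiv \<alpha> u \<bullet> vderiv \<alpha> u" if "u \<in> I" for u
      using unit_speed[OF that] by (simp add: norm_eq_1)
  qed
  ultimately have "vderiv \<alpha> s \<bullet> vderiv (vderiv \<alpha>) s + vderiv (vderiv \<alpha>) s \<bullet> vderiv \<alpha> s = 0"
    by (rule vector_derivative_unique_at)
  then have orth: "T s \<bullet> vderiv (vderiv \<alpha>) s = 0" by (simp add: T inner_commute)
  consider
    (curved) "curvature \<alpha> s \<noteq> 0" "N s = (1 / curvature \<alpha> s) *\<^sub>R vderiv (vderiv \<alpha>) s"
      "B s = cross3 (T s) (N s)"
  | (straight) "norm (N s) = 1" "norm (B s) = 1" "T s \<bullet> N s = 0" "T s \<bullet> B s = 0" "N s \<bullet> B s = 0"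
    using frame s unfolding frenet_frame_def by auto
  then have "norm (N s) = 1 \<and> norm (B s) = 1 \<and> T s \<bullet> N s = 0 \<and> T s \<bullet> B s = 0 \<and> N s \<bullet> B s = 0"
  proof cases
    case curved
    have N1: "norm (N s) = 1" using curved by (simp add: curvature_def)
    have TN: "T s \<bullet> N s = 0" using orth curved by simp
    have "(norm (B s))\<^sup>2 = 1"
      using norm_cross_dot[of "T s" "N s"] T1 N1 TN unfolding curved(3) by simp
    then have "norm (B s) = 1"
      by (simp add: power2_eq_1_iff) (use norm_ge_zero[of "B s"] in linarith)
    then show ?thesis using N1 TN curved(3) by (simp add: dot_cross_self)
  next
    case straight
    then show ?thesis by simp
  qed
  then show "norm (N s) = 1" "norm (B s) = 1" "T s \<bullet> N s = 0" "T s \<bullet> B s = 0" "N s \<bullet> B s = 0"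
    by auto
qed

lemma envelope_deriv:
  assumes s: "s \<in> I"
  shows "vderiv (\<lambda>u. (norm (x - \<alpha> u))\<^sup>2 - (r u)\<^sup>2) s = - 2 * ((x - \<alpha> s) \<bullet> T s) - 2 * canal_R r s"
proof -
  have T: "T s = vderiv \<alpha> s" using frame s by (simp add: frenet_frame_def)
  have a: "((\<lambda>u. x - \<alpha> u) has_vector_derivative (0 - vderiv \<alpha> s)) (at s)"
    by (intro has_vector_derivative_diff has_vector_derivative_const
        smooth_on_intervalD[OF smooth_center s])
  have b: "(r has_vector_derivative vderiv r s) (at s)"
    by (rule smooth_on_intervalD[OF smooth_radius s])
  have "((\<lambda>u. (x - \<alpha> u) \<bullet> (x - \<alpha> u) - r u * r u) has_vector_derivative
      ((x - \<alpha> s) \<bullet> (0 - vderiv \<alpha> s) + (0 - vderiv \<alpha> s) \<bullet> (x - \<alpha> s)) - (r s * vderiv r s + vderiv r s * r s)) (at s)"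
    by (intro has_vector_derivative_diff bounded_bilinear.has_vector_derivative
        [OF bounded_bilinear_inner a a] has_vector_derivative_mult b)
  from vector_derivative_at[OF this] show ?thesis
    unfolding vderiv_def[of "\<lambda>u. (norm (x - \<alpha> u))\<^sup>2 - (r u)\<^sup>2"]
    unfolding power2_norm_eq_inner power2_eq_square[of "r _"]
    by (simp add: T canal_R_def inner_commute)
qed

theorem canal_param_image:
  "(\<lambda>(s, t). canal_param \<alpha> r T N B \<epsilon> s t) ` (I \<times> UNIV) = sphere_envelope I \<alpha> r"
proof (intro equalityI subsetI)
  fix x assume "x \<in> (\<lambda>(s, t). canal_param \<alpha> r T N B \<epsilon> s t) ` (I \<times> UNIV)"
  then obtain s t where s: "s \<in> I" and x: "x = canal_param \<alpha> r T N B \<epsilon> s t" by auto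
  note fr = frame_orthonormal[OF s]
  define R Q where "R = canal_R r s" and "Q = canal_Q \<epsilon> r s"
  have xa: "x - \<alpha> s = - R *\<^sub>R T s - (Q * cos t) *\<^sub>R N s + (Q * sin t) *\<^sub>R B s"
    by (simp add: x canal_param_def R_def Q_def)
  have "(norm (x - \<alpha> s))\<^sup>2 = R\<^sup>2 + (Q * cos t)\<^sup>2 + (Q * sin t)\<^sup>2"
    unfolding xa power2_norm_eq_inner using fr
    by (simp add: norm_eq_1 inner_diff_left inner_diff_right inner_add_left inner_add_right
        inner_commute power2_eq_square)
  also have "\<dots> = R\<^sup>2 + Q\<^sup>2 * ((cos t)\<^sup>2 + (sin t)\<^sup>2)"
    by (simp only: power_mult_distrib distrib_left add.assoc)
  also have "\<dots> = R\<^sup>2 + Q\<^sup>2" by simp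
  also have "\<dots> = (r s)\<^sup>2"
    using radius_deriv[OF s] sign
    by (auto simp: R_def Q_def canal_R_def canal_Q_def power_mult_distrib algebra_simps)
  finally have 1: "(norm (x - \<alpha> s))\<^sup>2 - (r s)\<^sup>2 = 0" by simp
  have "(x - \<alpha> s) \<bullet> T s = - R"
    unfolding xa using fr
    by (simp add: norm_eq_1 inner_diff_left inner_add_left inner_commute inner_diff_right inner_add_right)
  then have "vderiv (\<lambda>u. (norm (x - \<alpha> u))\<^sup>2 - (r u)\<^sup>2) s = 0"
    by (simp add: envelope_deriv[OF s] R_def)
  with 1 s show "x \<in> sphere_envelope I \<alpha> r" by (auto simp: sphere_envelope_def)
next
  fix x assume "x \<in> sphere_envelope I \<alpha> r"
  then obtain s where s: "s \<in> I" and 1: "(norm (x - \<alpha> s))\<^sup>2 - (r s)\<^sup>2 = 0"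
    and 2: "vderiv (\<lambda>u. (norm (x - \<alpha> u))\<^sup>2 - (r u)\<^sup>2) s = 0"
    by (auto simp: sphere_envelope_def)
  note fr = frame_orthonormal[OF s]
  define R Q y where "R = canal_R r s" and "Q = canal_Q \<epsilon> r s" and "y = x - \<alpha> s"
  have yT: "y \<bullet> T s = - R" using 2 by (simp add: envelope_deriv[OF s] R_def y_def)
  have y: "y = (y \<bullet> T s) *\<^sub>R T s + (y \<bullet> N s) *\<^sub>R N s + (y \<bullet> B s) *\<^sub>R B s"
    by (rule orthonormal_expansion_3) (use fr in auto)
  define p q where "p = y \<bullet> N s" and "q = y \<bullet> B s"
  have y': "y = (- R) *\<^sub>R T s + p *\<^sub>R N s + q *\<^sub>R B s"
    using y by (simp add: yT p_def q_def)
  have "(norm y)\<^sup>2 = R\<^sup>2 + p\<^sup>2 + q\<^sup>2"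
    unfolding power2_norm_eq_inner using fr
    by (subst (1 2) y') (simp add: norm_eq_1 inner_diff_left inner_diff_right inner_add_left
        inner_add_right inner_commute power2_eq_square)
  moreover have "R\<^sup>2 + Q\<^sup>2 = (r s)\<^sup>2"
    using radius_deriv[OF s] sign
    by (auto simp: R_def Q_def canal_R_def canal_Q_def power_mult_distrib algebra_simps)
  ultimately have pq: "p\<^sup>2 + q\<^sup>2 = Q\<^sup>2" using 1 by (simp add: y_def)
  obtain t where t: "p = - (Q * cos t)" "q = Q * sin t"
  proof (cases "Q = 0")
    case True
    then have "p = 0" "q = 0" using pq by (simp_all add: sum_power2_eq_zero_iff)
    then show ?thesis using that True by simp
  next
    case False
    have "(- p / Q)\<^sup>2 + (q / Q)\<^sup>2 = (p\<^sup>2 + q\<^sup>2) / Q\<^sup>2"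
      by (simp add: power_divide add_divide_distrib)
    also have "\<dots> = 1" using pq False by simp
    finally obtain t where "- p / Q = cos t" "q / Q = sin t"
      using sincos_total_2pi by blast
    then show ?thesis using that False by (metis minus_equation_iff nonzero_mult_div_cancel_left times_divide_eq_right)
  qed
  have "x = canal_param \<alpha> r T N B \<epsilon> s t"
    using y' unfolding y_def canal_param_def R_def[symmetric] Q_def[symmetric] t
    by (simp add: algebra_simps)
  with s show "x \<in> (\<lambda>(s, t). canal_param \<alpha> r T N B \<epsilon> s t) ` (I \<times> UNIV)" by auto
qed

end

end

theory Submission
  imports Defs
begin

text \<open>
  The surface touches each sphere of the family along its characteristic circle, so the unit
  normal at \<open>C s t\<close> is \<open>\<sigma> (C s t - \<alpha> s) / r s\<close> with \<open>\<sigma> = \<plusminus>1\<close> (\<open>normal_radial\<close>);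
  by continuity the sign \<open>\<sigma>\<close> is constant.
  Differentiating the relations \<open>C\<^sub>s \<bullet> (C - \<alpha>) = 0\<close> and \<open>C\<^sub>t \<bullet> (C - \<alpha>) = 0\<close> expresses the second
  fundamental form through the first one and the single scalar \<open>A = C\<^sub>s \<bullet> T\<close>:
  \<open>r e = \<sigma> (A - E)\<close>, \<open>r f = - \<sigma> F\<close>, \<open>r g = - \<sigma> G\<close>. Moreover \<open>G = Q\<^sup>2\<close> and
  \<open>E G - F\<^sup>2 = (r A)\<^sup>2\<close> (\<open>first_form_discriminant\<close>). With
  \<open>\<rho> = A G / (E G - F\<^sup>2) = (1 - r'\<^sup>2) / A\<close> this gives (\<open>canal_curvatures\<close>)
  \<open>K = (1 - \<rho>) / r\<^sup>2\<close> and \<open>H = - \<sigma> (2 - \<rho>) / (2 r)\<close>; in other words, the principal curvatures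
  are \<open>- \<sigma> / r\<close>, inherited from the sphere, and \<open>- \<sigma> (1 - \<rho>) / r\<close>.

  Differentiating \<open>(C - \<alpha>) \<bullet> T = - R\<close> and using \<open>T' = \<kappa> N\<close> yields
  \<open>A = 1 - R' + \<kappa> Q cos t\<close>. If \<open>\<kappa> = 0\<close>, then \<open>\<rho>\<close>, hence \<open>H\<close> and
  \<open>K\<close>, depend on \<open>s\<close> only. If \<open>r\<close> and \<open>\<kappa>\<close> are constant, then \<open>R' = 0\<close> and \<open>Q\<close> is
  constant, so \<open>H\<close> and \<open>K\<close> depend on \<open>t\<close> only. In both cases every term of the Jacobi function
  contains a vanishing partial derivative.
\<close>

section \<open>Twice differentiable functions on an open set\<close>

text \<open>
  The derivatives are existentially quantified functions, only required to be right on \<open>I\<close>, so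
  that closure properties can be proved by exhibiting formulas.
\<close>

definition twice_diff :: "real set \<Rightarrow> (real \<Rightarrow> 'a::real_normed_vector) \<Rightarrow> bool" where
  "twice_diff I f \<longleftrightarrow> (\<exists>f1 f2. \<forall>s\<in>I.
     (f has_vector_derivative f1 s) (at s) \<and> (f1 has_vector_derivative f2 s) (at s))"

lemma twice_diffI:
  assumes "\<And>s. s \<in> I \<Longrightarrow> (f has_vector_derivative f1 s) (at s)"
    and "\<And>s. s \<in> I \<Longrightarrow> (f1 has_vector_derivative f2 s) (at s)"
  shows "twice_diff I f"
  using assms unfolding twice_diff_def by blast

lemma twice_diffD:
  assumes "twice_diff I f" "open I" "s \<in> I"
  shows "(f has_vector_derivative vderiv f s) (at s)"
    and "(vderiv f has_vector_derivative vderiv (vderiv f) s) (at s)"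
proof -
  obtain f1 f2 where f1: "\<And>u. u \<in> I \<Longrightarrow> (f has_vector_derivative f1 u) (at u)"
    and f2: "\<And>u. u \<in> I \<Longrightarrow> (f1 has_vector_derivative f2 u) (at u)"
    using assms(1) unfolding twice_diff_def by blast
  have eq: "f1 u = vderiv f u" if "u \<in> I" for u
    using vector_derivative_at[OF f1[OF that]] by (simp add: vderiv_def)
  show "(f has_vector_derivative vderiv f s) (at s)"
    using f1 eq assms(3) by simp
  have "(vderiv f has_vector_derivative f2 s) (at s)"
    by (rule has_vector_derivative_transform_within_open[OF f2 assms(2,3) eq]) (use assms in auto)
  then show "(vderiv f has_vector_derivative vderiv (vderiv f) s) (at s)"
    using vector_derivative_at by (fastforce simp: vderiv_def)
qed

lemma twice_diff_imp_continuous_on: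
  assumes "twice_diff I f"
  shows "continuous_on I f"
  using assms unfolding twice_diff_def
  by (meson continuous_at_imp_continuous_on has_vector_derivative_continuous)

lemma twice_diff_cong:
  assumes "twice_diff I f" "open I" "\<And>s. s \<in> I \<Longrightarrow> f s = g s"
  shows "twice_diff I g"
proof (rule twice_diffI)
  fix s assume s: "s \<in> I"
  show "(g has_vector_derivative vderiv f s) (at s)"
    by (rule has_vector_derivative_transform_within_open
        [OF twice_diffD(1)[OF assms(1,2) s] assms(2) s assms(3)])
  show "(vderiv f has_vector_derivative vderiv (vderiv f) s) (at s)"
    by (rule twice_diffD(2)[OF assms(1,2) s])
qed

lemma twice_diff_const: "twice_diff I (\<lambda>s. c)"
  by (rule twice_diffI[where ?f1.0 = "\<lambda>s. 0" and ?f2.0 = "\<lambda>s. 0"]) auto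

lemma twice_diff_diff:
  assumes "twice_diff I f" "twice_diff I g" "open I"
  shows "twice_diff I (\<lambda>s. f s - g s)"
proof (rule twice_diffI)
  fix s assume s: "s \<in> I"
  note d = twice_diffD[OF assms(1,3) s] twice_diffD[OF assms(2,3) s]
  show "((\<lambda>s. f s - g s) has_vector_derivative vderiv f s - vderiv g s) (at s)"
    by (intro has_vector_derivative_diff d)
  show "((\<lambda>s. vderiv f s - vderiv g s) has_vector_derivative
      vderiv (vderiv f) s - vderiv (vderiv g) s) (at s)"
    by (intro has_vector_derivative_diff d)
qed

lemma (in bounded_bilinear) twice_diff:
  assumes "twice_diff I f" "twice_diff I g" "open I"
  shows "twice_diff I (\<lambda>s. prod (f s) (g s))"
proof (rule twice_diffI)
  fix s assume s: "s \<in> I"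
  note d = twice_diffD[OF assms(1,3) s] twice_diffD[OF assms(2,3) s]
  show "((\<lambda>s. prod (f s) (g s)) has_vector_derivative
      prod (f s) (vderiv g s) + prod (vderiv f s) (g s)) (at s)"
    by (intro has_vector_derivative d)
  show "((\<lambda>s. prod (f s) (vderiv g s) + prod (vderiv f s) (g s)) has_vector_derivative
      (prod (f s) (vderiv (vderiv g) s) + prod (vderiv f s) (vderiv g s)) +
      (prod (vderiv f s) (vderiv g s) + prod (vderiv (vderiv f) s) (g s))) (at s)"
    by (intro has_vector_derivative_add has_vector_derivative d)
qed

lemmas twice_diff_scaleR = bounded_bilinear.twice_diff[OF bounded_bilinear_scaleR]
lemmas twice_diff_mult = bounded_bilinear.twice_diff[OF bounded_bilinear_mult]
lemmas twice_diff_inner = bounded_bilinear.twice_diff[OF bounded_bilinear_inner]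

lemma bounded_bilinear_cross3: "bounded_bilinear cross3"
  using bilinear_cross bilinear_conv_bounded_bilinear by blast

lemma twice_diff_compose_real:
  fixes f g g1 g2 :: "real \<Rightarrow> real"
  assumes f: "twice_diff I f" and I: "open I"
    and g: "\<And>s. s \<in> I \<Longrightarrow> (g has_real_derivative g1 (f s)) (at (f s))"
      "\<And>s. s \<in> I \<Longrightarrow> (g1 has_real_derivative g2 (f s)) (at (f s))"
  shows "twice_diff I (\<lambda>s. g (f s))"
proof (rule twice_diffI)
  fix s assume s: "s \<in> I"
  note f1 = twice_diffD[OF f I s, folded has_real_derivative_iff_has_vector_derivative]
  show "((\<lambda>s. g (f s)) has_vector_derivative g1 (f s) * vderiv f s) (at s)"
    using DERIV_chain2[OF g(1)[OF s] f1(1)]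
    by (simp add: has_real_derivative_iff_has_vector_derivative)
  show "((\<lambda>s. g1 (f s) * vderiv f s) has_vector_derivative
      g1 (f s) * vderiv (vderiv f) s + g2 (f s) * vderiv f s * vderiv f s) (at s)"
    using DERIV_mult'[OF DERIV_chain2[OF g(2)[OF s] f1(1)] f1(2)]
    by (simp add: has_real_derivative_iff_has_vector_derivative)
qed

text \<open>
  Exponents \<open>1/2\<close> and \<open>-1/2\<close> give the square root in \<open>Q\<close> and the reciprocal of the curvature.
\<close>

lemma twice_diff_powr:
  fixes f :: "real \<Rightarrow> real"
  assumes f: "twice_diff I f" "open I" and pos: "\<And>s. s \<in> I \<Longrightarrow> f s > 0"
  shows "twice_diff I (\<lambda>s. f s powr a)"
proof (rule twice_diff_compose_real[OF f])
  fix s assume "s \<in> I"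
  note [simp] = pos[OF this]
  show "((\<lambda>x. x powr a) has_real_derivative (\<lambda>x. a * x powr (a - 1)) (f s)) (at (f s))"
    by (rule has_real_derivative_powr) simp
  show "((\<lambda>x. a * x powr (a - 1)) has_real_derivative
      (\<lambda>x. a * ((a - 1) * x powr (a - 1 - 1))) (f s)) (at (f s))"
    by (intro DERIV_cmult has_real_derivative_powr) simp
qed

lemma smooth_on_interval_twice_diff:
  assumes "smooth_on_interval I f"
  shows "twice_diff I ((vderiv ^^ k) f)"
proof (rule twice_diffI)
  fix s assume s: "s \<in> I"
  have *: "((vderiv ^^ j) f has_vector_derivative (vderiv ^^ Suc j) f s) (at s)" for j
    using assms s unfolding smooth_on_interval_def
    by (simp add: vector_derivative_works vderiv_def)
  show "((vderiv ^^ k) f has_vector_derivative (vderiv ^^ Suc k) f s) (at s)" by (rule *)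
  show "((vderiv ^^ Suc k) f has_vector_derivative (vderiv ^^ Suc (Suc k)) f s) (at s)" by (rule *)
qed

section \<open>Vector algebra in three dimensions\<close>

lemma inner_orthonormal_3:
  fixes a b c x :: "real^3"
  assumes "norm a = 1" "norm b = 1" "norm c = 1" "a \<bullet> b = 0" "a \<bullet> c = 0" "b \<bullet> c = 0"
  shows "x \<bullet> x = (x \<bullet> a)\<^sup>2 + (x \<bullet> b)\<^sup>2 + (x \<bullet> c)\<^sup>2"
proof -
  have "x \<bullet> x = x \<bullet> ((x \<bullet> a) *\<^sub>R a + (x \<bullet> b) *\<^sub>R b + (x \<bullet> c) *\<^sub>R c)"
    using orthonormal_expansion_3[OF assms] by simp
  then show ?thesis
    by (simp add: inner_add_right power2_eq_square)
qed

text \<open>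
  Everything orthogonal to both \<open>v\<close> and \<open>w\<close> is a multiple of \<open>cross3 v w\<close>, whose squared norm is
  the Gram determinant in the first hypothesis.
\<close>

lemma unit_normals_parallel:
  fixes v w m n :: "real^3"
  assumes indep: "(v \<bullet> v) * (w \<bullet> w) - (v \<bullet> w)\<^sup>2 \<noteq> 0"
    and m: "norm m = 1" "m \<bullet> v = 0" "m \<bullet> w = 0"
    and n: "norm n = 1" "n \<bullet> v = 0" "n \<bullet> w = 0"
  shows "n = (n \<bullet> m) *\<^sub>R m" and "n \<bullet> m = 1 \<or> n \<bullet> m = -1"
proof -
  define c where "c = cross3 v w"
  have c0: "c \<bullet> c \<noteq> 0"
    using norm_cross_dot[of v w] indep
    unfolding c_def power_mult_distrib power2_norm_eq_inner by linarith
  have par: "y = ((c \<bullet> y) / (c \<bullet> c)) *\<^sub>R c" if "y \<bullet> v = 0" "y \<bullet> w = 0" for y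
  proof -
    have "cross3 y c = 0" unfolding c_def Lagrange by (simp add: that)
    then have "(c \<bullet> c) *\<^sub>R y = (c \<bullet> y) *\<^sub>R c"
      using Lagrange[of c y c] by simp
    then have "(1 / (c \<bullet> c)) *\<^sub>R ((c \<bullet> c) *\<^sub>R y) = (1 / (c \<bullet> c)) *\<^sub>R ((c \<bullet> y) *\<^sub>R c)" by simp
    then show ?thesis using c0 by simp
  qed
  define k l where "k = (c \<bullet> n) / (c \<bullet> c)" and "l = (c \<bullet> m) / (c \<bullet> c)"
  have nk: "n = k *\<^sub>R c" and ml: "m = l *\<^sub>R c"
    using par m n unfolding k_def l_def by blast+
  have l: "l \<noteq> 0" using ml m(1) by auto
  have nm: "n = (k / l) *\<^sub>R m" unfolding nk ml using l by simp
  have inner: "n \<bullet> m = k / l"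
    by (subst nm) (use m(1) in \<open>simp add: norm_eq_1\<close>)
  show "n = (n \<bullet> m) *\<^sub>R m" using nm inner by simp
  have "\<bar>n \<bullet> m\<bar> = 1"
    using arg_cong[OF nm, of norm] n(1) m(1) unfolding inner norm_scaleR by (metis mult.right_neutral)
  then show "n \<bullet> m = 1 \<or> n \<bullet> m = -1" by linarith
qed

section \<open>Regular canal surfaces\<close>

locale regular_canal_surface = canal_surface +
  fixes n :: "real \<Rightarrow> real \<Rightarrow> real^3"
  assumes regular: "regular_surface I (canal_param \<alpha> r T N B \<epsilon>)"
    and normal: "unit_normal I (canal_param \<alpha> r T N B \<epsilon>) n"
begin

abbreviation "C \<equiv> canal_param \<alpha> r T N B \<epsilon>"
abbreviation "R \<equiv> canal_R r"
abbreviation "Q \<equiv> canal_Q \<epsilon> r"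

lemma T_eq: "s \<in> I \<Longrightarrow> T s = vderiv \<alpha> s"
  using frame by (simp add: frenet_frame_def)

lemma pd_t_C: "pd_t C s t = (Q s * sin t) *\<^sub>R N s + (Q s * cos t) *\<^sub>R B s"
  unfolding pd_t_def canal_param_def
  by (rule vector_derivative_at) (auto intro!: derivative_eq_intros simp: algebra_simps)

lemma pd_tt_C: "pd_t (pd_t C) s t = (Q s * cos t) *\<^sub>R N s - (Q s * sin t) *\<^sub>R B s"
  unfolding pd_t_def[of "pd_t C"] pd_t_C
  by (rule vector_derivative_at) (auto intro!: derivative_eq_intros simp: algebra_simps)

text \<open>Where \<open>Q\<close> vanishes, the characteristic circle degenerates to a point.\<close>

lemma Q_nonzero:
  assumes "s \<in> I"
  shows "Q s \<noteq> 0"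
proof
  assume "Q s = 0"
  then have "pd_t C s t = 0" for t by (simp add: pd_t_C)
  then show False
    using regular assms unfolding regular_surface_def ff_G_def ff_F_def by fastforce
qed

lemma radius_deriv_strict:
  assumes "s \<in> I"
  shows "(vderiv r s)\<^sup>2 < 1"
  using Q_nonzero[OF assms] radius_deriv[OF assms] by (fastforce simp: canal_Q_def)

lemma Q_square:
  assumes "s \<in> I"
  shows "(Q s)\<^sup>2 = (r s)\<^sup>2 * (1 - (vderiv r s)\<^sup>2)"
  using radius_deriv[OF assms] sign by (auto simp: canal_Q_def power_mult_distrib)

subsection \<open>Differentiability\<close>

lemma twice_diff_center: "twice_diff I \<alpha>" "twice_diff I (vderiv \<alpha>)"
    "twice_diff I (vderiv (vderiv \<alpha>))"
  using smooth_on_interval_twice_diff[OF smooth_center, of 0]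
    smooth_on_interval_twice_diff[OF smooth_center, of 1]
    smooth_on_interval_twice_diff[OF smooth_center, of 2]
  by (simp_all add: numeral_2_eq_2)

lemma twice_diff_radius: "twice_diff I r" "twice_diff I (vderiv r)"
  using smooth_on_interval_twice_diff[OF smooth_radius, of 0]
    smooth_on_interval_twice_diff[OF smooth_radius, of 1]
  by simp_all

lemma twice_diff_R: "twice_diff I R"
  unfolding canal_R_def
  by (intro twice_diff_mult twice_diff_radius interval)

text \<open>
  The square root in \<open>Q\<close> is singular where \<open>r'\<^sup>2 = 1\<close>; regularity keeps \<open>r'\<close> away from these values.
\<close>

lemma twice_diff_Q: "twice_diff I Q"
proof -
  have "twice_diff I (\<lambda>s. \<epsilon> * r s * (1 - vderiv r s * vderiv r s) powr (1/2))"
    using radius_deriv_strict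
    by (intro twice_diff_mult twice_diff_const twice_diff_radius interval twice_diff_powr
        twice_diff_diff) (simp add: power2_eq_square)
  then show ?thesis
    by (rule twice_diff_cong)
      (use interval radius_deriv in \<open>auto simp: canal_Q_def powr_half_sqrt power2_eq_square\<close>)
qed

lemma twice_diff_frame: "twice_diff I T" "twice_diff I N" "twice_diff I B"
proof -
  show T: "twice_diff I T"
    by (rule twice_diff_cong[OF twice_diff_center(2)]) (use interval T_eq in auto)
  have "twice_diff I N \<and> twice_diff I B"
  proof (cases "\<forall>s\<in>I. curvature \<alpha> s \<noteq> 0")
    case True
    then have N: "\<And>s. s \<in> I \<Longrightarrow> N s = (1 / curvature \<alpha> s) *\<^sub>R vderiv (vderiv \<alpha>) s"
      and B: "\<And>s. s \<in> I \<Longrightarrow> B s = cross3 (T s) (N s)"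
      using frame interval(3) unfolding frenet_frame_def by blast+
    let ?a = "vderiv (vderiv \<alpha>)"
    have "twice_diff I (\<lambda>s. ((?a s \<bullet> ?a s) powr (-1/2)) *\<^sub>R ?a s)"
      using True
      by (intro twice_diff_scaleR twice_diff_powr twice_diff_inner twice_diff_center interval)
        (simp add: curvature_def)
    then have 1: "twice_diff I N"
    proof (rule twice_diff_cong)
      fix s assume s: "s \<in> I"
      have "(?a s \<bullet> ?a s) powr (-1/2) = 1 / norm (?a s)"
        by (simp add: powr_minus powr_half_sqrt norm_eq_sqrt_inner inverse_eq_divide)
      then show "((?a s \<bullet> ?a s) powr (-1/2)) *\<^sub>R ?a s = N s"
        using N[OF s] by (simp add: curvature_def)
    qed (rule interval)
    have "twice_diff I (\<lambda>s. cross3 (T s) (N s))"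
      by (intro bounded_bilinear.twice_diff[OF bounded_bilinear_cross3] T 1 interval)
    then have "twice_diff I B"
      by (rule twice_diff_cong) (use interval B in auto)
    with 1 show ?thesis by simp
  next
    case False
    then obtain N0 B0 where "\<And>s. s \<in> I \<Longrightarrow> N0 = N s" "\<And>s. s \<in> I \<Longrightarrow> B0 = B s"
      using frame interval(3) unfolding frenet_frame_def by metis
    then show ?thesis
      using twice_diff_cong[OF twice_diff_const interval(1)] by blast
  qed
  then show "twice_diff I N" "twice_diff I B" by auto
qed

lemma deriv_T:
  assumes s: "s \<in> I"
  shows "(T has_vector_derivative curvature \<alpha> s *\<^sub>R N s) (at s)"
proof -
  have "vderiv (vderiv \<alpha>) s = curvature \<alpha> s *\<^sub>R N s"
    using frame s unfolding frenet_frame_def by (auto simp: curvature_def)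
  moreover have "(vderiv \<alpha> has_vector_derivative vderiv (vderiv \<alpha>) s) (at s)"
    by (rule smooth_on_intervalD[OF smooth_center s])
  ultimately show ?thesis
    using has_vector_derivative_transform_within_open[OF _ interval(1) s] T_eq by metis
qed

lemma pd_s_C_differentiable:
  assumes s: "s \<in> I"
  shows "((\<lambda>u. C u t) has_vector_derivative pd_s C s t) (at s)"
    and "((\<lambda>u. pd_s C u t) has_vector_derivative pd_s (pd_s C) s t) (at s)"
    and "((\<lambda>v. pd_s C s v) has_vector_derivative pd_t (pd_s C) s t) (at t)"
proof -
  \<comment> \<open>The dependence on \<open>t\<close> is only through \<open>cos t\<close> and \<open>sin t\<close> with coefficients in \<open>s\<close>.\<close>
  define X0 X1 X2 where "X0 = (\<lambda>u. \<alpha> u - R u *\<^sub>R T u)" and "X1 = (\<lambda>u. Q u *\<^sub>R N u)"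
    and "X2 = (\<lambda>u. Q u *\<^sub>R B u)"
  have C: "C u v = X0 u - cos v *\<^sub>R X1 u + sin v *\<^sub>R X2 u" for u v
    by (simp add: canal_param_def X0_def X1_def X2_def mult.commute)
  have X: "twice_diff I X0" "twice_diff I X1" "twice_diff I X2"
    unfolding X0_def X1_def X2_def
    by (intro twice_diff_diff twice_diff_scaleR twice_diff_center twice_diff_R twice_diff_Q
        twice_diff_frame interval)+
  note d = twice_diffD[OF X(1) interval(1)] twice_diffD[OF X(2) interval(1)]
    twice_diffD[OF X(3) interval(1)]
  have 1: "((\<lambda>u. C u v) has_vector_derivative
      vderiv X0 u - cos v *\<^sub>R vderiv X1 u + sin v *\<^sub>R vderiv X2 u) (at u)" if "u \<in> I" for u v
    unfolding C
    by (intro has_vector_derivative_add has_vector_derivative_diff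
        bounded_linear.has_vector_derivative[OF bounded_linear_scaleR_right] d that)
  then have Cs: "pd_s C u v = vderiv X0 u - cos v *\<^sub>R vderiv X1 u + sin v *\<^sub>R vderiv X2 u"
    if "u \<in> I" for u v
    unfolding pd_s_def by (rule vector_derivative_at[OF _]) (rule that)
  show "((\<lambda>u. C u t) has_vector_derivative pd_s C s t) (at s)"
    using 1[OF s] Cs[OF s] by simp
  have "((\<lambda>u. vderiv X0 u - cos t *\<^sub>R vderiv X1 u + sin t *\<^sub>R vderiv X2 u) has_vector_derivative
      vderiv (vderiv X0) s - cos t *\<^sub>R vderiv (vderiv X1) s + sin t *\<^sub>R vderiv (vderiv X2) s) (at s)"
    by (intro has_vector_derivative_add has_vector_derivative_diff
        bounded_linear.has_vector_derivative[OF bounded_linear_scaleR_right] d s)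
  then have "((\<lambda>u. pd_s C u t) has_vector_derivative
      vderiv (vderiv X0) s - cos t *\<^sub>R vderiv (vderiv X1) s + sin t *\<^sub>R vderiv (vderiv X2) s) (at s)"
    by (rule has_vector_derivative_transform_within_open[OF _ interval(1) s]) (simp add: Cs)
  then show "((\<lambda>u. pd_s C u t) has_vector_derivative pd_s (pd_s C) s t) (at s)"
    unfolding pd_s_def[of "pd_s C"] by (simp add: vector_derivative_at)
  have "((\<lambda>v. pd_s C s v) has_vector_derivative
      sin t *\<^sub>R vderiv X1 s + cos t *\<^sub>R vderiv X2 s) (at t)"
    unfolding Cs[OF s] by (auto intro!: derivative_eq_intros)
  then show "((\<lambda>v. pd_s C s v) has_vector_derivative pd_t (pd_s C) s t) (at t)"
    unfolding pd_t_def by (simp add: vector_derivative_at)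
qed

subsection \<open>The radial vector from the center of the sphere\<close>

definition rad :: "real \<Rightarrow> real \<Rightarrow> real^3" where
  "rad s t = C s t - \<alpha> s"

lemma rad_eq: "rad s t = - R s *\<^sub>R T s - (Q s * cos t) *\<^sub>R N s + (Q s * sin t) *\<^sub>R B s"
  by (simp add: rad_def canal_param_def)

lemma frame_inner:
  assumes "s \<in> I"
  shows "T s \<bullet> T s = 1" "N s \<bullet> N s = 1" "B s \<bullet> B s = 1"
    "T s \<bullet> N s = 0" "T s \<bullet> B s = 0" "N s \<bullet> B s = 0"
    "N s \<bullet> T s = 0" "B s \<bullet> T s = 0" "B s \<bullet> N s = 0"
  using frame_orthonormal[OF assms] by (simp_all add: norm_eq_1 inner_commute)

lemmas inner_expand = inner_diff_left inner_diff_right inner_add_left inner_add_right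

lemma rad_inner:
  assumes s: "s \<in> I"
  shows "rad s t \<bullet> rad s t = (r s)\<^sup>2" "rad s t \<bullet> T s = - R s" "rad s t \<bullet> N s = - (Q s * cos t)"
    "rad s t \<bullet> pd_t C s t = 0" "rad s t \<bullet> pd_t (pd_t C) s t = - (Q s)\<^sup>2"
proof -
  note fr = frame_inner[OF s]
  have sc: "x * (cos t)\<^sup>2 + x * (sin t)\<^sup>2 = x" for x
    by (metis distrib_left mult.right_neutral sin_cos_squared_add2)
  have "rad s t \<bullet> rad s t = (R s)\<^sup>2 + ((Q s)\<^sup>2 * (cos t)\<^sup>2 + (Q s)\<^sup>2 * (sin t)\<^sup>2)"
    unfolding rad_eq by (simp add: inner_expand fr power2_eq_square algebra_simps)
  then show "rad s t \<bullet> rad s t = (r s)\<^sup>2"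
    unfolding sc Q_square[OF s] canal_R_def by (simp add: power2_eq_square algebra_simps)
  show "rad s t \<bullet> T s = - R s" "rad s t \<bullet> N s = - (Q s * cos t)" "rad s t \<bullet> pd_t C s t = 0"
    unfolding rad_eq pd_t_C by (simp_all add: inner_expand fr)
  have "rad s t \<bullet> pd_t (pd_t C) s t = - ((Q s)\<^sup>2 * (cos t)\<^sup>2 + (Q s)\<^sup>2 * (sin t)\<^sup>2)"
    unfolding rad_eq pd_tt_C by (simp add: inner_expand fr power2_eq_square algebra_simps)
  then show "rad s t \<bullet> pd_t (pd_t C) s t = - (Q s)\<^sup>2" unfolding sc .
qed

lemma deriv_rad:
  assumes s: "s \<in> I"
  shows "((\<lambda>u. rad u t) has_vector_derivative pd_s C s t - T s) (at s)"
  unfolding rad_def T_eq[OF s]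
  by (intro has_vector_derivative_diff pd_s_C_differentiable smooth_on_intervalD[OF smooth_center] s)

lemma inner_derivative_eq:
  fixes f g :: "real \<Rightarrow> 'a::real_inner"
  assumes "(f has_vector_derivative f') (at s)" "(g has_vector_derivative g') (at s)"
    and "(h has_vector_derivative h') (at s)"
    and "s \<in> J" "open J" "\<And>u. u \<in> J \<Longrightarrow> f u \<bullet> g u = h u"
  shows "f s \<bullet> g' + f' \<bullet> g s = h'"
proof -
  have "((\<lambda>u. f u \<bullet> g u) has_vector_derivative f s \<bullet> g' + f' \<bullet> g s) (at s)"
    by (rule bounded_bilinear.has_vector_derivative[OF bounded_bilinear_inner assms(1,2)])
  then have "(h has_vector_derivative f s \<bullet> g' + f' \<bullet> g s) (at s)"
    by (rule has_vector_derivative_transform_within_open) (use assms in auto)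
  then show ?thesis using assms(3) vector_derivative_unique_at by blast
qed

text \<open>
  This is the derivative of the sphere equation \<open>\<parallel>C - \<alpha>\<parallel>\<^sup>2 = r\<^sup>2\<close> along \<open>s\<close>: the term
  \<open>r r'\<close> is compensated by \<open>(C - \<alpha>) \<bullet> T = - r r'\<close>, which is the envelope condition.
\<close>

lemma rad_orthogonal_pd_s:
  assumes s: "s \<in> I"
  shows "rad s t \<bullet> pd_s C s t = 0"
proof -
  have r: "(r has_vector_derivative vderiv r s) (at s)"
    by (rule smooth_on_intervalD[OF smooth_radius s])
  have "rad s t \<bullet> (pd_s C s t - T s) + (pd_s C s t - T s) \<bullet> rad s t
      = r s * vderiv r s + vderiv r s * r s"
    by (rule inner_derivative_eq[OF deriv_rad[OF s] deriv_rad[OF s]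
          has_vector_derivative_mult[OF r r] s interval(1)])
      (simp add: rad_inner power2_eq_square)
  then show ?thesis
    using rad_inner(2)[OF s] by (simp add: inner_expand inner_commute canal_R_def)
qed

text \<open>The scalar \<open>A = C\<^sub>s \<bullet> T\<close>, see \<open>pd_s_inner_T\<close>.\<close>

definition axial_speed :: "real \<Rightarrow> real \<Rightarrow> real" where
  "axial_speed s t = 1 - vderiv R s + curvature \<alpha> s * Q s * cos t"

lemma pd_s_inner_T:
  assumes s: "s \<in> I"
  shows "pd_s C s t \<bullet> T s = axial_speed s t"
proof -
  have "((\<lambda>u. - R u) has_vector_derivative - vderiv R s) (at s)"
    by (intro has_vector_derivative_minus twice_diffD[OF twice_diff_R] interval s)
  then have "rad s t \<bullet> (curvature \<alpha> s *\<^sub>R N s) + (pd_s C s t - T s) \<bullet> T s = - vderiv R s"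
    by (rule inner_derivative_eq[OF deriv_rad[OF s] deriv_T[OF s] _ s interval(1)])
      (simp add: rad_inner)
  then show ?thesis
    using rad_inner(3)[OF s] frame_inner[OF s] by (simp add: inner_expand axial_speed_def)
qed

text \<open>
  Differentiating the orthogonality \<open>(C - \<alpha>) \<bullet> C\<^sub>s = 0\<close> in \<open>s\<close> and in \<open>t\<close> moves one derivative
  from \<open>C\<^sub>s\<close> to \<open>C - \<alpha>\<close>, whose derivatives are \<open>C\<^sub>s - T\<close> and \<open>C\<^sub>t\<close>.
\<close>

lemma rad_inner_second_derivs:
  assumes s: "s \<in> I"
  shows "rad s t \<bullet> pd_s (pd_s C) s t = axial_speed s t - ff_E C s t"
    and "rad s t \<bullet> pd_t (pd_s C) s t = - ff_F C s t"
proof -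
  have "rad s t \<bullet> pd_s (pd_s C) s t + (pd_s C s t - T s) \<bullet> pd_s C s t = 0"
    by (rule inner_derivative_eq[OF deriv_rad[OF s] pd_s_C_differentiable(2)[OF s]
          has_vector_derivative_const s interval(1)])
      (simp add: rad_orthogonal_pd_s)
  then show "rad s t \<bullet> pd_s (pd_s C) s t = axial_speed s t - ff_E C s t"
    using pd_s_inner_T[OF s, of t] by (simp add: inner_expand ff_E_def inner_commute)
  have "((\<lambda>v. rad s v) has_vector_derivative pd_t C s t) (at t)"
    unfolding rad_eq pd_t_C by (auto intro!: derivative_eq_intros simp: mult.commute)
  then have "rad s t \<bullet> pd_t (pd_s C) s t + pd_t C s t \<bullet> pd_s C s t = 0"
    by (rule inner_derivative_eq[OF _ pd_s_C_differentiable(3)[OF s]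
          has_vector_derivative_const _ open_UNIV])
      (simp_all add: rad_orthogonal_pd_s s)
  then show "rad s t \<bullet> pd_t (pd_s C) s t = - ff_F C s t"
    by (simp add: ff_F_def inner_commute)
qed

subsection \<open>The first fundamental form\<close>

lemma ff_G_eq:
  assumes s: "s \<in> I"
  shows "ff_G C s t = (Q s)\<^sup>2"
proof -
  have "ff_G C s t = (Q s)\<^sup>2 * ((sin t)\<^sup>2 + (cos t)\<^sup>2)"
    unfolding ff_G_def pd_t_C
    by (simp del: sin_cos_squared_add sin_cos_squared_add2 sin_cos_squared_add3 add: frame_inner[OF s] inner_expand power2_eq_square algebra_simps)
  then show ?thesis by simp
qed

text \<open>
  Let \<open>P\<close> and \<open>P'\<close> be the radial and tangential unit vectors in the plane of the
  characteristic circle. In the orthonormal frame \<open>T, P, P'\<close> the vector \<open>C\<^sub>t\<close> is \<open>Q P'\<close>, so that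
  \<open>E G - F\<^sup>2\<close> is \<open>Q\<^sup>2\<close> times the squared norm of the \<open>T, P\<close> part of \<open>C\<^sub>s\<close>. Orthogonality of \<open>C\<^sub>s\<close>
  to \<open>C - \<alpha> = Q P - R T\<close> fixes the ratio of these two components, and \<open>Q\<^sup>2 + R\<^sup>2 = r\<^sup>2\<close>.
\<close>

lemma first_form_discriminant:
  assumes s: "s \<in> I"
  shows "ff_E C s t * ff_G C s t - (ff_F C s t)\<^sup>2 = (r s * axial_speed s t)\<^sup>2"
proof -
  note fr = frame_inner[OF s]
  define P P' V where "P = sin t *\<^sub>R B s - cos t *\<^sub>R N s"
    and "P' = sin t *\<^sub>R N s + cos t *\<^sub>R B s" and "V = pd_s C s t"
  have sc: "sin t * sin t + cos t * cos t = 1"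
    using sin_cos_squared_add[of t] by (simp add: power2_eq_square)
  have on: "norm (T s) = 1" "norm P = 1" "norm P' = 1" "T s \<bullet> P = 0" "T s \<bullet> P' = 0" "P \<bullet> P' = 0"
    unfolding norm_eq_1 P_def P'_def using sc by (simp_all add: inner_expand fr add.commute)
  have rad: "rad s t = Q s *\<^sub>R P - R s *\<^sub>R T s"
    unfolding rad_eq P_def by (simp add: algebra_simps)
  have F: "ff_F C s t = Q s * (V \<bullet> P')"
    unfolding ff_F_def pd_t_C V_def P'_def by (simp add: inner_expand algebra_simps)
  have T: "V \<bullet> T s = axial_speed s t" unfolding V_def by (rule pd_s_inner_T[OF s])
  have P: "Q s * (V \<bullet> P) = R s * axial_speed s t"
    using rad_orthogonal_pd_s[OF s, of t] T unfolding rad V_def[symmetric]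
    by (simp add: inner_expand inner_commute)
  have "ff_E C s t = (axial_speed s t)\<^sup>2 + (V \<bullet> P)\<^sup>2 + (V \<bullet> P')\<^sup>2"
    unfolding ff_E_def V_def[symmetric] T[symmetric] by (rule inner_orthonormal_3[OF on])
  then have "ff_E C s t * ff_G C s t - (ff_F C s t)\<^sup>2
      = (Q s)\<^sup>2 * (axial_speed s t)\<^sup>2 + (Q s * (V \<bullet> P))\<^sup>2"
    unfolding F ff_G_eq[OF s] by (simp add: power_mult_distrib algebra_simps)
  also have "\<dots> = ((Q s)\<^sup>2 + (R s)\<^sup>2) * (axial_speed s t)\<^sup>2"
    unfolding P by (simp add: power_mult_distrib algebra_simps)
  also have "(Q s)\<^sup>2 + (R s)\<^sup>2 = (r s)\<^sup>2"
    unfolding Q_square[OF s] canal_R_def by (simp add: power_mult_distrib algebra_simps)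
  finally show ?thesis by (simp add: power_mult_distrib)
qed

lemma axial_speed_nonzero:
  assumes "s \<in> I"
  shows "axial_speed s t \<noteq> 0"
  using regular first_form_discriminant[OF assms, of t] assms
  unfolding regular_surface_def by fastforce

subsection \<open>The unit normal and the curvatures\<close>

text \<open>
  The sign compares \<open>n\<close> with the radial unit vector; it is a continuous function with two
  possible values on the connected set \<open>I \<times> UNIV\<close>.
\<close>

lemma normal_radial:
  obtains \<sigma> where "\<sigma> = 1 \<or> \<sigma> = -1" "\<And>s t. s \<in> I \<Longrightarrow> n s t = (\<sigma> / r s) *\<^sub>R rad s t"
proof -
  define \<nu> where "\<nu> s t = (1 / r s) *\<^sub>R rad s t" for s t
  define g where "g = (\<lambda>(s, t). n s t \<bullet> \<nu> s t)"
  have *: "n s t = (n s t \<bullet> \<nu> s t) *\<^sub>R \<nu> s t" "n s t \<bullet> \<nu> s t = 1 \<or> n s t \<bullet> \<nu> s t = -1"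
    if s: "s \<in> I" for s t
  proof -
    have "norm (rad s t) = r s"
      using rad_inner(1)[OF s] radius_pos[OF s] by (simp add: norm_eq_sqrt_inner)
    then have \<nu>: "norm (\<nu> s t) = 1" "\<nu> s t \<bullet> pd_s C s t = 0" "\<nu> s t \<bullet> pd_t C s t = 0"
      unfolding \<nu>_def using rad_orthogonal_pd_s[OF s] rad_inner(4)[OF s] radius_pos[OF s]
      by simp_all
    have nn: "norm (n s t) = 1" "n s t \<bullet> pd_s C s t = 0" "n s t \<bullet> pd_t C s t = 0"
      using normal s unfolding unit_normal_def by auto
    have "(pd_s C s t \<bullet> pd_s C s t) * (pd_t C s t \<bullet> pd_t C s t) - (pd_s C s t \<bullet> pd_t C s t)\<^sup>2 \<noteq> 0"
      using regular s unfolding regular_surface_def ff_E_def ff_F_def ff_G_def by blast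
    from unit_normals_parallel[OF this \<nu> nn]
    show "n s t = (n s t \<bullet> \<nu> s t) *\<^sub>R \<nu> s t" "n s t \<bullet> \<nu> s t = 1 \<or> n s t \<bullet> \<nu> s t = -1" by auto
  qed
  have c: "continuous_on (I \<times> (UNIV :: real set)) (\<lambda>p. f (fst p))" if "twice_diff I f"
    for f :: "real \<Rightarrow> 'b::real_normed_vector"
    by (rule continuous_on_compose2[OF twice_diff_imp_continuous_on[OF that]])
      (auto intro: continuous_intros)
  have "continuous_on (I \<times> (UNIV :: real set)) (\<lambda>p. n (fst p) (snd p) \<bullet> \<nu> (fst p) (snd p))"
    unfolding \<nu>_def rad_eq
    using normal radius_pos unfolding unit_normal_def
    by (intro continuous_intros c twice_diff_R twice_diff_Q twice_diff_frame twice_diff_radius)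
      (fastforce simp: case_prod_unfold)+
  then have "continuous_on (I \<times> UNIV) g" by (simp add: g_def case_prod_unfold)
  moreover have "connected (I \<times> (UNIV :: real set))"
    using interval(2) by (intro connected_Times) (auto simp: is_interval_connected)
  moreover have "finite (g ` (I \<times> UNIV))"
    by (rule finite_subset[of _ "{1, -1}"]) (use *(2) in \<open>auto simp: g_def\<close>)
  ultimately have "g constant_on (I \<times> UNIV)"
    using continuous_finite_range_constant by blast
  then obtain \<sigma> where \<sigma>: "\<And>s t. s \<in> I \<Longrightarrow> n s t \<bullet> \<nu> s t = \<sigma>"
    unfolding constant_on_def g_def by auto
  show ?thesis
  proof
    show "\<sigma> = 1 \<or> \<sigma> = -1" using \<sigma> *(2) interval(3) by (metis all_not_in_conv)
    show "n s t = (\<sigma> / r s) *\<^sub>R rad s t" if "s \<in> I" for s t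
      using *(1)[OF that, of t] unfolding \<sigma>[OF that] by (simp add: \<nu>_def)
  qed
qed

text \<open>
  The deviation from a sphere: the ratio of the two principal curvatures is \<open>1 - \<rho>\<close>, and
  \<open>\<rho> = 0\<close> would be an umbilic point.
\<close>

definition \<rho> :: "real \<Rightarrow> real \<Rightarrow> real" where
  "\<rho> s t = (1 - (vderiv r s)\<^sup>2) / axial_speed s t"

text \<open>
  The second fundamental form is \<open>- \<sigma> / r\<close> times the first one, except for the extra term
  \<open>\<sigma> A / r\<close> in \<open>e\<close>; hence the curvatures differ from those of a sphere of radius \<open>r\<close> only by
  the contribution \<open>\<rho> = A G / (E G - F\<^sup>2)\<close> of this term.
\<close>

theorem canal_curvatures:
  obtains \<sigma> where "\<sigma> = 1 \<or> \<sigma> = -1"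
    "\<And>s t. s \<in> I \<Longrightarrow> gauss_curvature C n s t = (1 - \<rho> s t) / (r s)\<^sup>2"
    "\<And>s t. s \<in> I \<Longrightarrow> mean_curvature C n s t = - \<sigma> * (2 - \<rho> s t) / (2 * r s)"
proof -
  obtain \<sigma> where \<sigma>: "\<sigma> = 1 \<or> \<sigma> = -1"
    and n: "\<And>s t. s \<in> I \<Longrightarrow> n s t = (\<sigma> / r s) *\<^sub>R rad s t"
    using normal_radial by blast
  have "gauss_curvature C n s t = (1 - \<rho> s t) / (r s)\<^sup>2 \<and>
      mean_curvature C n s t = - \<sigma> * (2 - \<rho> s t) / (2 * r s)" if s: "s \<in> I" for s t
  proof -
    define E F G A k W where "E = ff_E C s t" and "F = ff_F C s t" and "G = ff_G C s t"
      and "A = axial_speed s t" and "k = \<sigma> / r s" and "W = E * G - F\<^sup>2"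
    have r: "r s > 0" by (rule radius_pos[OF s])
    have A: "A \<noteq> 0" unfolding A_def by (rule axial_speed_nonzero[OF s])
    have second: "sf_e C n s t = k * (A - E)" "sf_f C n s t = - k * F" "sf_g C n s t = - k * G"
      unfolding sf_e_def sf_f_def sf_g_def n[OF s] k_def A_def E_def F_def G_def
      using rad_inner_second_derivs[OF s, of t] rad_inner(5)[OF s, of t] ff_G_eq[OF s, of t]
      by (simp_all add: inner_commute)
    have W: "W = (r s)\<^sup>2 * A\<^sup>2"
      using first_form_discriminant[OF s, of t]
      by (simp add: W_def E_def F_def G_def A_def power_mult_distrib)
    have W0: "W \<noteq> 0" using W r A by simp
    have "G = (r s)\<^sup>2 * (1 - (vderiv r s)\<^sup>2)"
      unfolding G_def ff_G_eq[OF s] Q_square[OF s] ..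
    then have \<rho>: "A * G = W * \<rho> s t"
      unfolding W \<rho>_def A_def[symmetric] using A by (simp add: power2_eq_square)
    have k2: "k\<^sup>2 = 1 / (r s)\<^sup>2" using \<sigma> by (auto simp: k_def power_divide)
    have "(k * (A - E)) * (- k * G) - (- k * F)\<^sup>2 = k\<^sup>2 * (W - A * G)"
      by (simp add: W_def power2_eq_square algebra_simps)
    also have "\<dots> = W * (k\<^sup>2 * (1 - \<rho> s t))" by (simp add: \<rho> algebra_simps)
    finally have "gauss_curvature C n s t = k\<^sup>2 * (1 - \<rho> s t)"
      unfolding gauss_curvature_def second E_def[symmetric] F_def[symmetric] G_def[symmetric]
        W_def[symmetric]
      using W0 by simp
    moreover have "E * (- k * G) - 2 * F * (- k * F) + G * (k * (A - E)) = - k * (2 * W - A * G)"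
      by (simp add: W_def power2_eq_square algebra_simps)
    then have "E * (- k * G) - 2 * F * (- k * F) + G * (k * (A - E)) = W * (- k * (2 - \<rho> s t))"
      by (simp add: \<rho> algebra_simps)
    then have "mean_curvature C n s t = - k * (2 - \<rho> s t) / 2"
      unfolding mean_curvature_def second E_def[symmetric] F_def[symmetric] G_def[symmetric]
        W_def[symmetric]
      using W0 by simp
    ultimately show ?thesis unfolding k2 by (simp add: k_def)
  qed
  with \<sigma> show ?thesis using that by blast
qed

subsection \<open>Two classes of Weingarten canal surfaces\<close>

lemma weingarten_straight:
  assumes "\<And>s. s \<in> I \<Longrightarrow> curvature \<alpha> s = 0"
  shows "weingarten I (mean_curvature C n) (gauss_curvature C n)"
proof -
  obtain \<sigma> where
    K: "\<And>s t. s \<in> I \<Longrightarrow> gauss_curvature C n s t = (1 - \<rho> s t) / (r s)\<^sup>2" and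
    H: "\<And>s t. s \<in> I \<Longrightarrow> mean_curvature C n s t = - \<sigma> * (2 - \<rho> s t) / (2 * r s)"
    using canal_curvatures by metis
  have "pd_t (mean_curvature C n) s t = 0 \<and> pd_t (gauss_curvature C n) s t = 0"
    if s: "s \<in> I" for s t
  proof -
    define p where "p = \<rho> s 0"
    have \<rho>: "\<rho> s v = p" for v by (simp add: p_def \<rho>_def axial_speed_def assms s)
    have "mean_curvature C n s = (\<lambda>v. - \<sigma> * (2 - p) / (2 * r s))"
      "gauss_curvature C n s = (\<lambda>v. (1 - p) / (r s)\<^sup>2)"
      using s by (simp_all add: fun_eq_iff K H \<rho>)
    then show ?thesis by (simp add: pd_t_def)
  qed
  then show ?thesis by (simp add: weingarten_def jacobi_fun_def)
qed

lemma weingarten_tube: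
  assumes r: "\<And>s. s \<in> I \<Longrightarrow> r s = a" and \<kappa>: "\<And>s. s \<in> I \<Longrightarrow> curvature \<alpha> s = c"
  shows "weingarten I (mean_curvature C n) (gauss_curvature C n)"
proof -
  obtain \<sigma> where
    K: "\<And>s t. s \<in> I \<Longrightarrow> gauss_curvature C n s t = (1 - \<rho> s t) / (r s)\<^sup>2" and
    H: "\<And>s t. s \<in> I \<Longrightarrow> mean_curvature C n s t = - \<sigma> * (2 - \<rho> s t) / (2 * r s)"
    using canal_curvatures by metis
  have vderiv_0: "vderiv f s = 0" if "s \<in> I" "\<And>u. u \<in> I \<Longrightarrow> f u = b"
    for f :: "real \<Rightarrow> real" and b s
  proof -
    have "(f has_vector_derivative 0) (at s)"
      by (rule has_vector_derivative_transform_within_open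
          [OF has_vector_derivative_const[of b] interval(1) that(1)]) (simp add: that(2))
    then show ?thesis by (simp add: vderiv_def vector_derivative_at)
  qed
  have r': "vderiv r s = 0" if "s \<in> I" for s by (rule vderiv_0[OF that r])
  have R': "vderiv R s = 0" if "s \<in> I" for s
    by (rule vderiv_0[OF that, of _ 0]) (simp add: canal_R_def r')
  have \<rho>: "\<rho> s t = 1 / (1 + c * (\<epsilon> * a) * cos t)" if "s \<in> I" for s t
    using that by (simp add: \<rho>_def axial_speed_def r' R' \<kappa> canal_Q_def r)
  have "pd_s (mean_curvature C n) s t = 0" "pd_s (gauss_curvature C n) s t = 0"
    if s: "s \<in> I" for s t
  proof -
    have "vderiv (\<lambda>u. mean_curvature C n u t) s = 0"
      by (rule vderiv_0[OF s]) (simp add: H \<rho> r)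
    then show "pd_s (mean_curvature C n) s t = 0" by (simp add: pd_s_def vderiv_def)
    have "vderiv (\<lambda>u. gauss_curvature C n u t) s = 0"
      by (rule vderiv_0[OF s]) (simp add: K \<rho> r)
    then show "pd_s (gauss_curvature C n) s t = 0" by (simp add: pd_s_def vderiv_def)
  qed
  then show ?thesis by (simp add: weingarten_def jacobi_fun_def)
qed

end

theorem theorem2p1:
  fixes I :: "real set" and \<alpha> :: "real \<Rightarrow> real^3" and r :: "real \<Rightarrow> real"
    and T N B :: "real \<Rightarrow> real^3" and \<epsilon> :: real
    and C n :: "real \<Rightarrow> real \<Rightarrow> real^3"
  assumes canal: "canal_surface I \<alpha> r T N B \<epsilon>"
    and C_def: "C = canal_param \<alpha> r T N B \<epsilon>"
    and regular: "regular_surface I C"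
    and normal: "unit_normal I C n"
    and type_of_surface: "surface_of_revolution I \<alpha> \<or> cylinder I \<alpha> r \<or>
       (tubular I r \<and> (\<exists>c. c \<noteq> 0 \<and> (\<forall>s\<in>I. curvature \<alpha> s = c)))"
  shows "weingarten I (mean_curvature C n) (gauss_curvature C n)"
proof -
  interpret canal_surface I \<alpha> r T N B \<epsilon> by (rule canal)
  interpret regular_canal_surface I \<alpha> r T N B \<epsilon> n
    by unfold_locales (use regular normal in \<open>simp_all add: C_def\<close>)
  \<comment> \<open>A cylinder has a straight center curve, so it falls into the first case.\<close>
  consider (straight) "\<forall>s\<in>I. curvature \<alpha> s = 0"
    | (tube) a c where "\<forall>s\<in>I. r s = a" "\<forall>s\<in>I. curvature \<alpha> s = c"
    using type_of_surface
    unfolding surface_of_revolution_def cylinder_def tubular_def by blast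
  then show ?thesis
  proof cases
    case straight
    then show ?thesis unfolding C_def by (intro weingarten_straight) simp
  next
    case tube
    then show ?thesis unfolding C_def by (intro weingarten_tube[of a c]) simp_all
  qed
qed

end
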